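(* Fix $k, m \geq 1$. For each $n\ge mk+1$ let $\lambda_n\vdash n$ be a partition all of whose parts have size at least $mk+1$. Let $X=X_{n_0}$ be a symmetric permutation statistic on $S_{n_0}$ induced by a constraint set $\mathcal{C}$ of size $m$ supported on $[n_0]$, and let $(X_n)$ be its symmetric extension. Then there exists a polynomial $p_X$, depending only on $X$, such that $p_X(n)=\mathbb{E}_{\lambda_n}[X_n^k]$ for all $n$ (for which $\lambda_n$ is defined).
   Context: $S_n$ is the symmetric group on $[n]$; $\mathbb{E}_\lambda$ is expectation under the uniform measure on the conjugacy class $C_\lambda\subseteq S_n$ of cycle type $\lambda\vdash n$. A constraint is a set $P=\{(i_1,j_1),\dots,(i_\ell,j_\ell)\}$ of distinct pairs of positive integers; its size is $\ell$, and its support is the set of distinct elements among $i_1,\dots,i_\ell,j_1,\dots,j_\ell$. A permutation $\omega$ satisfies $P$ if $\omega(i_t)=j_t$ for all $t$; $I_P$ is the indicator of this. The size of a set $\mathcal{C}$ of constraints is the maximum size of its members. The unweighted constraint statistic induced by $\mathcal{C}$ (a set of constraints with supports in $[n]$) is $X=\sum_{P\in\mathcal{C}}I_P$ on $S_n$. A function $f$ from a subset $A\subseteq[n]$ to $[n]$ is order-preserving if $a<b\iff f(a)<f(b)$ for $a,b\in A$; for such $f$ defined on the support of $P$, $f(P)=\{(f(i_1),f(j_1)),\dots,(f(i_\ell),f(j_\ell))\}$. The statistic $X$ induced by $\mathcal{C}$ on $S_n$ is symmetric if $f(P)\in\mathcal{C}$ for every $P\in\mathcal{C}$ and every order-preserving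 $f$ from the support of $P$ into $[n]$. Given a symmetric statistic $X$ on $S_{n_0}$ induced by $\mathcal{C}$ supported on $[n_0]$, its symmetric extension $(X_n)_{n\ge1}$ is defined by letting $X_n$ be the unweighted constraint statistic on $S_n$ induced by $\mathcal{C}_n$, where: if $n\le n_0$, $\mathcal{C}_n$ consists of all $P\in\mathcal{C}$ with support contained in $[n]$; if $n>n_0$, $\mathcal{C}_n$ consists of all $P\in\mathcal{C}$ together with all $f(P)$ for $P\in\mathcal{C}$ and order-preserving $f:[n_0]\to[n]$ (repeated constraints counted once). *)

theory Defs
  imports
    "HOL-Probability.Probability"
    "HOL-Combinatorics.Combinatorics"
    "HOL-Computational_Algebra.Polynomial"
begin

section \<open>Partitions and conjugacy classes\<close>

definition is_partition :: "nat \<Rightarrow> nat multiset \<Rightarrow> bool" where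
  "is_partition n lam \<longleftrightarrow> sum_mset lam = n \<and> (\<forall>a \<in># lam. a \<ge> 1)"

text \<open>Elements of $S_n$ are functions on \<open>nat\<close> that permute \<open>{1..n}\<close> and fix everything else.
  The orbits are collected over \<open>{1..n}\<close> only, so that fixed points inside $[n]$ (and no others)
  contribute parts equal to 1.\<close>

definition cycle_type :: "nat \<Rightarrow> (nat \<Rightarrow> nat) \<Rightarrow> nat multiset" where
  "cycle_type n w = image_mset card (mset_set (orbit w ` {1..n}))"

definition conj_class :: "nat \<Rightarrow> nat multiset \<Rightarrow> (nat \<Rightarrow> nat) set" where
  "conj_class n lam = {w. w permutes {1..n} \<and> cycle_type n w = lam}"

definition conj_expectation :: "nat \<Rightarrow> nat multiset \<Rightarrow> ((nat \<Rightarrow> nat) \<Rightarrow> real) \<Rightarrow> real" where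
  "conj_expectation n lam X = measure_pmf.expectation (pmf_of_set (conj_class n lam)) X"

section \<open>Constraints and constraint statistics\<close>

type_synonym constraint = "(nat \<times> nat) set"

definition support :: "constraint \<Rightarrow> nat set" where
  "support P = fst ` P \<union> snd ` P"

definition satisfies :: "(nat \<Rightarrow> nat) \<Rightarrow> constraint \<Rightarrow> bool" where
  "satisfies w P \<longleftrightarrow> (\<forall>(i, j) \<in> P. w i = j)"

text \<open>Finiteness of the constraints and of the family follows from the bound on the supports.\<close>

definition supported_on :: "nat \<Rightarrow> constraint set \<Rightarrow> bool" where
  "supported_on n C \<longleftrightarrow> (\<forall>P \<in> C. support P \<subseteq> {1..n})"

definition size_of :: "constraint set \<Rightarrow> nat" where
  "size_of C = Max (card ` C)"

definition statistic :: "constraint set \<Rightarrow> (nat \<Rightarrow> nat) \<Rightarrow> real" where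
  "statistic C w = (\<Sum>P \<in> C. of_bool (satisfies w P))"

section \<open>Symmetric statistics and their extensions\<close>

definition order_preserving :: "nat set \<Rightarrow> nat \<Rightarrow> (nat \<Rightarrow> nat) \<Rightarrow> bool" where
  "order_preserving A n f \<longleftrightarrow>
     f ` A \<subseteq> {1..n} \<and> (\<forall>a \<in> A. \<forall>b \<in> A. a < b \<longleftrightarrow> f a < f b)"

definition relabel :: "(nat \<Rightarrow> nat) \<Rightarrow> constraint \<Rightarrow> constraint" where
  "relabel f P = map_prod f f ` P"

text \<open>Symmetry of the statistic on $S_n$ induced by \<open>C\<close> is a property of the inducing
  constraint set: the same function on $S_n$ may be induced by several sets.\<close>

definition symmetric :: "nat \<Rightarrow> constraint set \<Rightarrow> bool" where
  "symmetric n C \<longleftrightarrow>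
     (\<forall>P \<in> C. \<forall>f. order_preserving (support P) n f \<longrightarrow> relabel f P \<in> C)"

definition extension_constraints :: "nat \<Rightarrow> constraint set \<Rightarrow> nat \<Rightarrow> constraint set" where
  "extension_constraints n0 C n =
     (if n \<le> n0 then {P \<in> C. support P \<subseteq> {1..n}}
      else C \<union> {relabel f P | f P. P \<in> C \<and> order_preserving {1..n0} n f})"

definition symmetric_extension :: "nat \<Rightarrow> constraint set \<Rightarrow> nat \<Rightarrow> (nat \<Rightarrow> nat) \<Rightarrow> real" where
  "symmetric_extension n0 C n = statistic (extension_constraints n0 C n)"

end

theory Submission
  imports Defs
begin

text \<open>Suppose all cycles of a permutation class on \<open>{1..n}\<close> are longer than \<open>L\<close>. A constraint with
  \<open>l \<le> L\<close> edges that is satisfied at all is a disjoint union of directed paths, and then its probability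
  is \<open>1 / ((n - 1) \<cdots> (n - l))\<close>, independently of the cycle type and of the lengths of the paths. Expanding
  the \<open>k\<close>-th power of the statistic gives a sum of indicators of unions \<open>Q\<close> of \<open>k\<close> constraints, with
  multiplicities that are invariant under increasing relabellings. Grouping by the size \<open>u\<close> of the support,
  each standardized \<open>Q\<close> contributes a multiple of \<open>n choose u\<close> divided by \<open>(n - 1) \<cdots> (n - l)\<close>, which
  is a polynomial since a union of paths has more vertices than edges.\<close>

section \<open>Conjugacy classes and the permutations satisfying a constraint\<close>

lemma orbit_conjugate:
  assumes "bij s"
  shows "orbit (s \<circ> w \<circ> inv s) (s x) = s ` orbit w x"
proof -
  have "((s \<circ> w \<circ> inv s) ^^ t) (s x) = s ((w ^^ t) x)" for t
    by (induction t) (use assms in \<open>auto simp: bij_is_inj\<close>)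
  then show ?thesis
    unfolding orbit_altdef by auto
qed

lemma cycle_type_conjugate:
  assumes "s permutes {1..n}"
  shows "cycle_type n (s \<circ> w \<circ> inv s) = cycle_type n w"
proof -
  have bij: "bij s"
    using assms by (rule permutes_bij)
  have "orbit (s \<circ> w \<circ> inv s) ` {1..n} = orbit (s \<circ> w \<circ> inv s) ` s ` {1..n}"
    using permutes_image[OF assms] by simp
  also have "\<dots> = (`) s ` orbit w ` {1..n}"
    by (simp add: image_image orbit_conjugate[OF bij])
  finally have eq: "orbit (s \<circ> w \<circ> inv s) ` {1..n} = (`) s ` orbit w ` {1..n}" .
  have inj: "inj s"
    using bij by (rule bij_is_inj)
  have "mset_set ((`) s ` orbit w ` {1..n}) = image_mset ((`) s) (mset_set (orbit w ` {1..n}))"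
    by (rule image_mset_mset_set[symmetric]) (simp add: inj_on_def inj_image_eq_iff[OF inj])
  then show ?thesis
    unfolding cycle_type_def eq
    by (simp add: multiset.map_comp comp_def card_image inj_on_subset[OF inj])
qed

lemma conj_class_conjugate:
  assumes "s permutes {1..n}" "w \<in> conj_class n lam"
  shows "s \<circ> w \<circ> inv s \<in> conj_class n lam"
  using assms unfolding conj_class_def
  by (auto simp: cycle_type_conjugate intro!: permutes_compose permutes_inv)

lemma finite_conj_class: "finite (conj_class n lam)"
  unfolding conj_class_def
  by (rule finite_subset[OF _ finite_permutations[of "{1..n}"]]) auto

text \<open>By induction on the parts: a permutation with the remaining parts is extended by one
  cycle on the next \<open>a\<close> numbers. Nonemptiness gives \<open>pmf_of_set\<close> its
  intended meaning as the uniform measure.\<close>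

lemma conj_class_nonempty:
  assumes "is_partition n lam"
  shows "conj_class n lam \<noteq> {}"
  using assms
proof (induction lam arbitrary: n)
  case empty
  then have "id \<in> conj_class n {#}"
    by (auto simp: is_partition_def conj_class_def cycle_type_def permutes_id)
  then show ?case by blast
next
  case (add a lam)
  define n' where "n' = sum_mset lam"
  have a: "a \<ge> 1" and n: "n = n' + a"
    using add.prems by (auto simp: is_partition_def n'_def)
  have "is_partition n' lam"
    using add.prems by (auto simp: is_partition_def n'_def)
  from add.IH[OF this] obtain v where v: "v permutes {1..n'}" "cycle_type n' v = lam"
    unfolding conj_class_def by blast
  \<comment> \<open>The new part becomes the cycle \<open>c\<close>, a cyclic shift of the block
    \<open>B\<close> of the \<open>a\<close> largest numbers; outside \<open>B\<close> it is the
    identity.\<close>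
  define B where "B = {n'+1..n'+a}"
  define c where "c x = (if x \<in> B then if x = n' + a then n' + 1 else x + 1 else x)" for x
  have "inj_on c B"
    unfolding inj_on_def c_def B_def by auto
  moreover have "c ` B \<subseteq> B"
    unfolding c_def B_def by auto
  ultimately have "bij_betw c B B"
    by (simp add: bij_betw_def endo_inj_surj B_def)
  then have c: "c permutes B"
    by (rule bij_imp_permutes) (simp add: c_def)
  define w where "w = v \<circ> c"
  have "w permutes {1..n}"
    unfolding w_def
    by (rule permutes_compose)
      (rule permutes_subset[OF c] permutes_subset[OF v(1)], force simp: B_def n)+
  have w_B: "w x = c x" if "x \<in> B" for x
  proof -
    have "c x \<notin> {1..n'}"
      using that unfolding c_def B_def by auto
    then show ?thesis
      using v(1) by (simp add: w_def permutes_not_in)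
  qed
  have w_old: "w x = v x" if "x \<in> {1..n'}" for x
    using that by (simp add: w_def c_def B_def)
  have pow: "(w ^^ t) (n' + 1) = n' + 1 + t" if "t < a" for t
    using that by (induction t) (auto simp: w_B c_def B_def)
  have "(w ^^ a) (n' + 1) = n' + 1"
  proof -
    obtain b where b: "a = Suc b"
      using a by (cases a) auto
    have "(w ^^ a) (n' + 1) = w ((w ^^ b) (n' + 1))"
      by (simp add: b)
    also have "\<dots> = n' + 1"
      by (subst pow) (auto simp: w_B c_def B_def b)
    finally show ?thesis .
  qed
  then have "orbit w (n' + 1) = {(w ^^ t) (n' + 1) | t. t < a}"
    using a by (intro orbit_altdef_bounded) auto
  also have "\<dots> = (\<lambda>t. n' + 1 + t) ` {..<a}"
    using pow by force
  also have "\<dots> = B"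
  proof -
    have "x \<in> (\<lambda>t. n' + 1 + t) ` {..<a}" if "x \<in> B" for x
      using that by (intro image_eqI[of _ _ "x - (n' + 1)"]) (auto simp: B_def)
    then show ?thesis
      by (auto simp: B_def)
  qed
  finally have "cyclic_on w B"
    unfolding cyclic_on_def using a by (intro bexI[of _ "n' + 1"]) (auto simp: B_def)
  then have orb_B: "orbit w x = B" if "x \<in> B" for x
    using that by (rule orbit_cyclic_eq3)
  have orb_sub: "orbit v x \<subseteq> {1..n'}" if "x \<in> {1..n'}" for x
    using permutes_orbit_subset[OF v(1) that] .
  have perm_v: "permutation v"
    using v(1) by (auto simp: permutation_permutes)
  have orb_old: "orbit w x = orbit v x" if "x \<in> {1..n'}" for x
  proof (rule orbit_cong)
    show "x \<in> orbit v x"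
      using perm_v by (rule permutation_self_in_orbit)
    show "w y = v y" if "y \<in> orbit v x" for y
      using orb_sub[OF \<open>x \<in> {1..n'}\<close>] that w_old by auto
  qed
  have split: "{1..n} = {1..n'} \<union> B"
    by (auto simp: n B_def)
  have "B \<noteq> {}"
    using a by (auto simp: B_def)
  then have "orbit w ` {1..n} = insert B (orbit v ` {1..n'})"
    unfolding split image_Un using orb_old orb_B by (auto simp: image_iff)
  \<comment> \<open>\<open>cycle_type\<close> runs over a set of orbits, so the new orbit must
    differ from all old ones in order to add a part.\<close>
  moreover have "B \<notin> orbit v ` {1..n'}"
    using orb_sub \<open>B \<noteq> {}\<close> by (force simp: B_def)
  ultimately have "cycle_type n w = add_mset a lam"
    using v(2) by (simp add: cycle_type_def B_def)
  with \<open>w permutes {1..n}\<close> show ?case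
    unfolding conj_class_def by blast
qed

section \<open>Counting the permutations of a class that satisfy a constraint\<close>

lemma satisfies_iff: "satisfies w P \<longleftrightarrow> (\<forall>i j. (i, j) \<in> P \<longrightarrow> w i = j)"
  unfolding satisfies_def by auto

definition sat_perms :: "nat \<Rightarrow> nat multiset \<Rightarrow> constraint \<Rightarrow> (nat \<Rightarrow> nat) set" where
  "sat_perms n lam P = {w \<in> conj_class n lam. satisfies w P}"

lemma finite_sat_perms: "finite (sat_perms n lam P)"
  unfolding sat_perms_def using finite_conj_class by simp

lemma card_sat_perms_relabel:
  assumes s: "s permutes {1..n}"
  shows "card (sat_perms n lam (relabel s P)) = card (sat_perms n lam P)"
proof -
  have bij: "bij s"
    using s by (rule permutes_bij)
  have inv: "inv s permutes {1..n}"
    using s by (rule permutes_inv)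
  have 1: "s (inv s x) = x" "inv s (s x) = x" for x
    using permutes_inverses[OF s] by auto
  have inv_inv: "inv (inv s) = s"
    using bij by (rule inv_inv_eq)
  have "bij_betw (\<lambda>w. s \<circ> w \<circ> inv s) (sat_perms n lam P) (sat_perms n lam (relabel s P))"
  proof (rule bij_betw_byWitness[where f' = "\<lambda>w. inv s \<circ> w \<circ> s"])
    show "(\<lambda>w. s \<circ> w \<circ> inv s) ` sat_perms n lam P \<subseteq> sat_perms n lam (relabel s P)"
      using conj_class_conjugate[OF s]
      by (auto simp: sat_perms_def satisfies_iff relabel_def 1)
    show "(\<lambda>w. inv s \<circ> w \<circ> s) ` sat_perms n lam (relabel s P) \<subseteq> sat_perms n lam P"
      using conj_class_conjugate[OF inv]
      by (fastforce simp: sat_perms_def satisfies_iff relabel_def 1 inv_inv)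
  qed (auto simp: 1 fun_eq_iff)
  then show ?thesis
    using bij_betw_same_card by metis
qed

text \<open>Out-degree and in-degree are at most one and there is no cycle: for finite
  \<open>P\<close> the graph is a disjoint union of directed paths. Acyclicity also rules out loops,
  that is, prescribed fixed points.\<close>

definition path_forest :: "constraint \<Rightarrow> bool" where
  "path_forest P \<longleftrightarrow> single_valued P \<and> single_valued (P\<inverse>) \<and> acyclic P"

text \<open>Since \<open>w\<close> is a function and injective, degrees are at most one. A cycle of
  \<open>P\<close> would yield an orbit of \<open>w\<close> with at most \<open>L\<close> elements,
  against the lower bound on all parts.\<close>

lemma path_forest_if_satisfied:
  assumes P: "finite P" "card P \<le> L" "fst ` P \<subseteq> {1..n}"
    and lam: "\<forall>a \<in># lam. L < a"
    and w: "w \<in> sat_perms n lam P"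
  shows "path_forest P"
proof -
  have sat: "(x, y) \<in> P \<Longrightarrow> w x = y" for x y
    using w unfolding sat_perms_def satisfies_def by auto
  have w': "w permutes {1..n}" "cycle_type n w = lam"
    using w unfolding sat_perms_def conj_class_def by auto
  have "single_valued P"
    using sat by (auto simp: single_valued_def)
  moreover have "single_valued (P\<inverse>)"
  proof (rule single_valuedI)
    fix y x x' assume "(y, x) \<in> P\<inverse>" "(y, x') \<in> P\<inverse>"
    then have "w x = w x'"
      using sat by simp
    then show "x = x'"
      using permutes_inj[OF w'(1)] by (simp add: inj_eq)
  qed
  moreover have "acyclic P"
  proof (rule acyclicI, rule allI, rule notI)
    fix x assume cyc: "(x, x) \<in> P\<^sup>+"
    \<comment> \<open>In a finite relation a closed walk can be taken no longer than the number of
      edges, which is what bounds the orbit by \<open>L\<close>.\<close>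
    then obtain t where t: "0 < t" "t \<le> card P" "(x, x) \<in> P ^^ t"
      using P(1) by (auto simp: trancl_finite_eq_relpow)
    have pow: "(x, y) \<in> P ^^ t \<Longrightarrow> (w ^^ t) x = y" for t y
      by (induction t arbitrary: y) (auto dest: sat)
    have "orbit w x = {(w ^^ m) x | m. m < t}"
      using pow[OF t(3)] t(1) by (rule orbit_altdef_bounded)
    also have "\<dots> = (\<lambda>m. (w ^^ m) x) ` {..<t}"
      by auto
    finally have "card (orbit w x) \<le> t"
      using card_image_le[of "{..<t}" "\<lambda>m. (w ^^ m) x"] by simp
    moreover have "x \<in> {1..n}"
      using tranclD[OF cyc] P(3) by force
    then have "card (orbit w x) \<in># cycle_type n w"
      by (simp add: cycle_type_def)
    ultimately show False
      using lam t(2) P(2) w'(2) by fastforce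
  qed
  ultimately show ?thesis
    by (simp add: path_forest_def)
qed

text \<open>A start exists because \<open>P\<close> is well-founded; it is unique because backward
  steps are deterministic, so two backward walks from \<open>i\<close> are comparable. If nothing
  points to \<open>i\<close>, the start is \<open>i\<close> itself.\<close>

lemma unique_path_start:
  assumes "finite P" "path_forest P"
  shows "\<exists>!s. (s, i) \<in> P\<^sup>* \<and> s \<notin> Range P"
proof -
  have "wf P"
    using assms by (auto simp: path_forest_def intro: finite_acyclic_wf)
  then obtain s where s: "(s, i) \<in> P\<^sup>*" "\<And>y. (y, s) \<in> P \<Longrightarrow> (y, i) \<notin> P\<^sup>*"
    by (rule wfE_min[of P i "{s. (s, i) \<in> P\<^sup>*}"]) auto
  then have "s \<notin> Range P"
    by (blast intro: converse_rtrancl_into_rtrancl)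
  moreover have "s' = s''" 
    if "(s', i) \<in> P\<^sup>*" "s' \<notin> Range P" "(s'', i) \<in> P\<^sup>*" "s'' \<notin> Range P" for s' s''
  proof -
    have "(i, s') \<in> (P\<inverse>)\<^sup>*" "(i, s'') \<in> (P\<inverse>)\<^sup>*"
      using that by (auto simp: rtrancl_converse)
    then have "(s', s'') \<in> (P\<inverse>)\<^sup>* \<or> (s'', s') \<in> (P\<inverse>)\<^sup>*"
      using assms by (intro single_valued_confluent) (auto simp: path_forest_def)
    then show ?thesis
      using that by (auto elim: converse_rtranclE)
  qed
  ultimately show ?thesis
    using s(1) by blast
qed

section \<open>Supports, edge counts and ends of unions of paths\<close>

lemma finite_support: "finite P \<Longrightarrow> finite (support P)"
  unfolding support_def by simp

lemma support_insert: "support (insert (i, j) P) = insert i (insert j (support P))"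
  unfolding support_def by auto

lemma constraint_subset_support: "P \<subseteq> support P \<times> support P"
  unfolding support_def by force

lemma finite_constraint: "finite (support P) \<Longrightarrow> finite P"
  by (rule finite_subset[OF constraint_subset_support]) simp

lemma Domain_subset_support: "Domain P \<subseteq> support P"
  unfolding support_def by force

lemma Range_subset_support: "Range P \<subseteq> support P"
  unfolding support_def by force

lemma card_Range_path_forest:
  assumes "path_forest P"
  shows "card (Range P) = card P"
proof -
  have "inj_on snd P"
    using assms unfolding path_forest_def by (auto simp: inj_on_def dest: single_valuedD)
  then show ?thesis
    by (simp add: Range_snd card_image)
qed

lemma path_forest_insert:
  assumes "path_forest P" "i \<notin> Domain P" "j \<notin> Range P" "(j, i) \<notin> P\<^sup>*"
  shows "path_forest (insert (i, j) P)"
  using assms unfolding path_forest_def by (auto simp: single_valued_def)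

lemma path_forest_subset:
  assumes "path_forest Q" "P \<subseteq> Q"
  shows "path_forest P"
  using assms acyclic_subset[of Q P] unfolding path_forest_def single_valued_def by blast

lemma path_forest_last_edge:
  assumes "finite Q" "path_forest Q" "Q \<noteq> {}"
  obtains i j where "(i, j) \<in> Q" "j \<notin> Domain Q"
proof -
  have "wf (Q\<inverse>)"
    using assms by (auto simp: path_forest_def intro: finite_acyclic_wf_converse)
  obtain a b where "(a, b) \<in> Q"
    using assms(3) by auto
  then have "b \<in> Range Q"
    by blast
  from wfE_min[OF \<open>wf (Q\<inverse>)\<close> this] obtain j
    where "j \<in> Range Q" "\<And>y. (y, j) \<in> Q\<inverse> \<Longrightarrow> y \<notin> Range Q"
    by blast
  then show ?thesis
    using that by blast
qed

text \<open>The last edge \<open>(i, j)\<close> of a path of \<open>Q\<close> is removed and the mass of the remaining constraint is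
  split according to the new image of \<open>i\<close>. The images outside the support are exchanged by
  conjugation; the other admissible ones join two paths and thereby shrink the support.\<close>

lemma card_sat_perms:
  assumes lam: "\<forall>a \<in># lam. L < a" and L: "L < n"
    and "path_forest Q" "support Q \<subseteq> {1..n}" "card Q \<le> L"
  shows "card (sat_perms n lam Q) * (\<Prod>j = 1..card Q. n - j) = card (conj_class n lam)"
  using assms(3-5)
proof (induction "card Q" arbitrary: Q)
  case 0
  then have "Q = {}"
    using finite_constraint[OF finite_subset[OF "0.prems"(2)]] by simp
  then show ?case
    by (simp add: sat_perms_def satisfies_def)
next
  case (Suc l)
  note outer_IH = Suc.hyps(1)
  \<comment> \<open>The inner induction keeps the number of edges fixed and decreases the support:
    joining two paths uses the same number of edges but does without the vertex
    \<open>j\<close>.\<close>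
  from Suc.hyps(2)[symmetric] Suc.prems show ?case
  proof (induction "card (support Q)" arbitrary: Q rule: less_induct)
    case less
    have fin_Q: "finite Q"
      using finite_constraint[OF finite_subset[OF less.prems(3)]] by simp
    have "Q \<noteq> {}"
      using less.prems(1) by auto
    with fin_Q less.prems(2) obtain i j where ij: "(i, j) \<in> Q" "j \<notin> Domain Q"
      by (rule path_forest_last_edge)
    define P where "P = Q - {(i, j)}"
    have Q_eq: "Q = insert (i, j) P"
      using ij by (auto simp: P_def)
    have fin_P: "finite P" and card_P: "card P = l"
      using fin_Q ij less.prems(1) by (auto simp: P_def)
    have pf_P: "path_forest P"
      using less.prems(2) by (rule path_forest_subset) (auto simp: P_def)
    have i_Dom: "i \<notin> Domain P" and j_Ran: "j \<notin> Range P"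
      using less.prems(2) ij unfolding path_forest_def P_def single_valued_def by blast+
    have j_Dom: "j \<notin> Domain P"
      using ij by (auto simp: P_def)
    have "j \<noteq> i"
      using ij by auto
    have j_supp: "j \<notin> support P"
      using j_Ran j_Dom by (auto simp: support_def)
    have supp_Q: "support Q = insert i (insert j (support P))"
      by (simp add: Q_eq support_insert)
    have in_n: "i \<in> {1..n}" "j \<in> {1..n}" and supp_P: "support P \<subseteq> {1..n}"
      using less.prems(3) by (auto simp: supp_Q)
    define c where "c j' = card (sat_perms n lam (insert (i, j') P))" for j'
    have "sat_perms n lam P = (\<Union>j' \<in> {1..n}. sat_perms n lam (insert (i, j') P))"
    proof -
      have "w i \<in> {1..n}" if "w \<in> conj_class n lam" for w
      proof -
        have "w permutes {1..n}"
          using that by (simp add: conj_class_def)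
        then show ?thesis
          using in_n(1) by (simp only: permutes_in_image)
      qed
      then show ?thesis
        by (auto simp: sat_perms_def satisfies_iff)
    qed
    moreover have "card \<dots> = (\<Sum>j' \<in> {1..n}. c j')"
      unfolding c_def
      by (rule card_UN_disjoint) (simp_all add: finite_sat_perms, auto simp: sat_perms_def satisfies_iff)
    ultimately have total: "card (sat_perms n lam P) = (\<Sum>j' \<in> {1..n}. c j')"
      by simp
    obtain s where s: "(s, i) \<in> P\<^sup>*" "s \<notin> Range P"
      and s_uniq: "\<And>s'. (s', i) \<in> P\<^sup>* \<Longrightarrow> s' \<notin> Range P \<Longrightarrow> s' = s"
      using unique_path_start[OF fin_P pf_P, of i] by blast
    have s_in: "s \<in> insert i (support P)"
      using s(1) Domain_subset_support[of P] by (auto elim: converse_rtranclE)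
    \<comment> \<open>The possible images of \<open>i\<close> are sorted. In \<open>bad\<close>, the
      point \<open>s\<close> would close a cycle and a point of \<open>Range P\<close> would get a
      second preimage; \<open>fresh\<close> points lie on no path yet; \<open>merge\<close> consists
      of the starts of the other paths. The point \<open>i\<close> itself is always in
      \<open>bad\<close>.\<close>
    define bad where "bad = insert s (Range P)"
    define fresh where "fresh = {1..n} - insert i (support P)"
    define merge where "merge = {1..n} - bad - fresh"
    have bad_sub: "bad \<subseteq> insert i (support P)"
      using s_in Range_subset_support[of P] by (auto simp: bad_def)
    have card_bad: "card bad = Suc l"
      using s(2) fin_P card_Range_path_forest[OF pf_P] card_P by (simp add: bad_def finite_Range)
    have partition: "{1..n} = bad \<union> fresh \<union> merge" 
      and disj: "bad \<inter> fresh = {}" "bad \<inter> merge = {}" "fresh \<inter> merge = {}"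
      using bad_sub in_n supp_P by (auto simp: fresh_def merge_def)
    have fin: "finite bad" "finite fresh" "finite merge"
      using fin_P by (auto simp: bad_def fresh_def merge_def finite_Range)
    have zero: "c j' = 0" if bad: "j' \<in> bad" for j'
    proof -
      let ?Q' = "insert (i, j') P"
      have "(i, j') \<notin> P"
        using i_Dom by auto
      then have card': "card ?Q' = Suc l"
        using fin_P card_P by simp
      have "\<not> path_forest ?Q'"
      proof (cases "j' = s")
        case True
        then show ?thesis
          using s by (auto simp: path_forest_def)
      next
        case False
        then obtain i' where "(i', j') \<in> P"
          using bad by (auto simp: bad_def)
        moreover have "i' \<noteq> i"
          using calculation i_Dom by auto
        ultimately show ?thesis
          by (auto simp: path_forest_def single_valued_def)
      qed
      moreover have "fst ` ?Q' \<subseteq> {1..n}"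
        using in_n supp_P by (auto simp: support_def)
      ultimately have "sat_perms n lam ?Q' = {}"
        using path_forest_if_satisfied[of ?Q' L n lam] fin_P card' less.prems(1,4) lam by auto
      then show ?thesis
        by (simp add: c_def)
    qed
    \<comment> \<open>The transposition of \<open>j\<close> and \<open>j'\<close> fixes
      \<open>i\<close> and every vertex of \<open>P\<close>, hence carries \<open>Q\<close> to the
      constraint with \<open>j'\<close> in place of \<open>j\<close>.\<close>
    have const: "c j' = card (sat_perms n lam Q)" if "j' \<in> fresh" for j'
    proof -
      let ?t = "Transposition.transpose j j'"
      have "?t permutes {1..n}"
        using that in_n by (intro permutes_swap_id) (auto simp: fresh_def)
      moreover have t_fix: "?t x = x" if "x \<in> insert i (support P)" for x
      proof (rule transpose_apply_other)
        show "x \<noteq> j"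
          using that j_supp \<open>j \<noteq> i\<close> by auto
        show "x \<noteq> j'"
          using that \<open>j' \<in> fresh\<close> by (auto simp: fresh_def)
      qed
      have "map_prod ?t ?t ` P = (\<lambda>e. e) ` P"
      proof (rule image_cong[OF refl])
        fix e assume "e \<in> P"
        then have "fst e \<in> support P" "snd e \<in> support P"
          by (auto simp: support_def)
        then have "?t (fst e) = fst e" "?t (snd e) = snd e"
          using t_fix by blast+
        then show "map_prod ?t ?t e = e"
          by (cases e) simp
      qed
      then have "relabel ?t Q = insert (i, j') P"
        using t_fix[of i] by (simp add: Q_eq relabel_def)
      ultimately show ?thesis
        using card_sat_perms_relabel[of ?t n lam Q] by (simp add: c_def)
    qed
    let ?D = "\<Prod>j = 1..Suc l. n - j"
    have known: "c j' * ?D = card (conj_class n lam)" if "j' \<in> merge" for j'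
    proof -
      let ?Q' = "insert (i, j') P"
      have j': "j' \<in> insert i (support P)" "j' \<in> {1..n}" "j' \<notin> bad"
        using that by (auto simp: merge_def fresh_def)
      have "(i, j') \<notin> P"
        using i_Dom by auto
      then have card': "card ?Q' = Suc l"
        using fin_P card_P by simp
      have supp': "support ?Q' = insert i (support P)"
        using j'(1) by (auto simp: support_insert)
      have "support ?Q' \<subset> support Q"
        using j_supp \<open>j \<noteq> i\<close> by (auto simp: supp' supp_Q)
      then have "card (support ?Q') < card (support Q)"
        using finite_support[OF fin_Q] by (rule psubset_card_mono[rotated])
      moreover have "path_forest ?Q'"
        using pf_P i_Dom j'(3) s_uniq by (intro path_forest_insert) (auto simp: bad_def)
      moreover have "support ?Q' \<subseteq> {1..n}"
        using in_n supp_P by (auto simp: supp')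
      ultimately have "card (sat_perms n lam ?Q') * (\<Prod>j = 1..card ?Q'. n - j) = card (conj_class n lam)"
        using less.hyps[of ?Q'] card' less.prems(1,4) by simp
      then show ?thesis
        by (simp add: c_def card')
    qed
    have D_eq: "?D = (\<Prod>j = 1..l. n - j) * (n - Suc l)"
      by simp
    \<comment> \<open>The \<open>l + 1\<close> points of \<open>bad\<close> leave
      \<open>n - Suc l\<close> admissible images, exactly the factor that \<open>?D\<close> has in
      addition to the product for \<open>P\<close>.\<close>
    have card_eq: "card fresh + card merge = n - Suc l"
    proof -
      have "n = card (bad \<union> fresh \<union> merge)"
        using arg_cong[OF partition, of card] by simp
      also have "\<dots> = card bad + card fresh + card merge"
        using fin disj by (subst card_Un_disjoint; auto simp: card_Un_disjoint)
      finally show ?thesis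
        using card_bad by simp
    qed
    have sum_split: "(\<Sum>j' \<in> {1..n}. c j') =
        card fresh * card (sat_perms n lam Q) + (\<Sum>j' \<in> merge. c j')"
    proof -
      have "(\<Sum>j' \<in> {1..n}. c j') = (\<Sum>j' \<in> bad. c j') + (\<Sum>j' \<in> fresh. c j') + (\<Sum>j' \<in> merge. c j')"
        unfolding partition using fin disj by (subst sum.union_disjoint; auto simp: sum.union_disjoint)
      then show ?thesis
        using zero const by simp
    qed
    \<comment> \<open>Scaled by \<open>?D\<close>, the total over all images is
      \<open>n - Suc l\<close> times the class size, and each image in \<open>merge\<close> accounts
      for one class size. The remainder belongs to \<open>fresh\<close>, and
      \<open>card fresh\<close> can be cancelled because \<open>j\<close> is fresh.\<close>
    have "card (sat_perms n lam P) * (\<Prod>j = 1..l. n - j) = card (conj_class n lam)"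
      using outer_IH[of P] card_P pf_P supp_P less.prems(1,4) by simp
    then have "card (conj_class n lam) * (n - Suc l) = (\<Sum>j' \<in> {1..n}. c j') * ?D"
      by (simp add: D_eq total mult.assoc)
    also have "\<dots> = card fresh * (card (sat_perms n lam Q) * ?D) + (\<Sum>j' \<in> merge. c j' * ?D)"
      unfolding sum_split by (simp only: sum_distrib_right distrib_right mult.assoc)
    also have "(\<Sum>j' \<in> merge. c j' * ?D) = card merge * card (conj_class n lam)"
      using known by simp
    finally have "card fresh * card (conj_class n lam) = card fresh * (card (sat_perms n lam Q) * ?D)"
      unfolding card_eq[symmetric] by (simp add: algebra_simps)
    moreover have "j \<in> fresh"
      using in_n j_supp \<open>j \<noteq> i\<close> by (simp add: fresh_def)
    then have "card fresh \<noteq> 0"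
      using fin by auto
    ultimately show ?case
      by (simp add: less.prems(1))
  qed
qed

section \<open>Relabelling constraints\<close>

lemma support_relabel: "support (relabel f P) = f ` support P"
  unfolding support_def relabel_def by (force simp: image_Un image_image)

lemma relabel_relabel: "relabel f (relabel g P) = relabel (f \<circ> g) P"
  unfolding relabel_def image_image by (rule image_cong[OF refl]) (simp add: prod.map_comp)

lemma relabel_cong:
  assumes "\<And>x. x \<in> support P \<Longrightarrow> f x = g x"
  shows "relabel f P = relabel g P"
  unfolding relabel_def
proof (rule image_cong[OF refl])
  fix e assume "e \<in> P"
  then have "fst e \<in> support P" "snd e \<in> support P"
    by (auto simp: support_def)
  then show "map_prod f f e = map_prod g g e"
    using assms by (cases e) simp
qed

lemma relabel_ident:
  assumes "\<And>x. x \<in> support P \<Longrightarrow> f x = x"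
  shows "relabel f P = P"
proof -
  have "relabel f P = relabel (\<lambda>x. x) P"
    by (rule relabel_cong) (rule assms)
  then show ?thesis
    by (simp add: relabel_def map_prod_ident)
qed

lemma relabel_Un: "relabel f (P \<union> Q) = relabel f P \<union> relabel f Q"
  unfolding relabel_def by (rule image_Un)

lemma relabel_the_inv_into:
  assumes "inj_on f S" "support P \<subseteq> S"
  shows "relabel (the_inv_into S f) (relabel f P) = P"
  unfolding relabel_relabel
  by (rule relabel_ident) (use assms in \<open>auto simp: the_inv_into_f_f\<close>)

lemma relabel_the_inv_into':
  assumes "inj_on f S" "support Q \<subseteq> f ` S"
  shows "relabel f (relabel (the_inv_into S f) Q) = Q"
  unfolding relabel_relabel
  by (rule relabel_ident) (use assms in \<open>auto intro: f_the_inv_into_f\<close>)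

lemma strict_mono_on_the_inv_into:
  fixes f :: "nat \<Rightarrow> nat"
  assumes "strict_mono_on S f"
  shows "strict_mono_on (f ` S) (the_inv_into S f)"
proof (rule strict_mono_onI)
  have inj: "inj_on f S"
    using assms by (rule strict_mono_on_imp_inj_on)
  fix a b assume "a \<in> f ` S" "b \<in> f ` S" "a < b"
  then obtain x y where "x \<in> S" "y \<in> S" "a = f x" "b = f y" "f x < f y"
    by auto
  then show "the_inv_into S f a < the_inv_into S f b"
    using strict_mono_on_less[OF assms] inj by (simp add: the_inv_into_f_f)
qed

lemma card_relabel:
  assumes "inj_on f (support P)"
  shows "card (relabel f P) = card P"
proof -
  have "inj_on (map_prod f f) P"
    by (rule inj_on_subset[OF map_prod_inj_on[OF assms assms]]) (rule constraint_subset_support)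
  then show ?thesis
    unfolding relabel_def by (rule card_image)
qed

lemma path_forest_relabelD:
  assumes inj: "inj_on f (support P)" and pf: "path_forest (relabel f P)"
  shows "path_forest P"
proof -
  have edge: "(f x, f y) \<in> relabel f P" if "(x, y) \<in> P" for x y
    using that by (force simp: relabel_def)
  have supp: "x \<in> support P" "y \<in> support P" if "(x, y) \<in> P" for x y
    using that by (force simp: support_def)+
  have "single_valued P" "single_valued (P\<inverse>)"
    using pf edge supp inj_onD[OF inj] unfolding path_forest_def single_valued_def converse_iff
    by metis+
  moreover have "(f x, f y) \<in> (relabel f P)\<^sup>+" if "(x, y) \<in> P\<^sup>+" for x y
    using that by induction (auto dest: edge intro: trancl_into_trancl)
  then have "acyclic P"
    using pf unfolding path_forest_def acyclic_def by blast
  ultimately show ?thesis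
    by (simp add: path_forest_def)
qed

lemma path_forest_relabel:
  assumes "inj_on f (support P)"
  shows "path_forest (relabel f P) \<longleftrightarrow> path_forest P"
proof
  assume "path_forest P"
  then have "path_forest (relabel (the_inv_into (support P) f) (relabel f P))"
    by (simp add: relabel_the_inv_into[OF assms])
  then show "path_forest (relabel f P)"
    by (rule path_forest_relabelD[rotated])
      (simp add: support_relabel inj_on_the_inv_into[OF assms])
qed (rule path_forest_relabelD[OF assms])

section \<open>Increasing maps, relabellings of the constraint set and the symmetric
  extension\<close>

lemma obtain_increasing_enumeration:
  fixes M :: "nat set"
  assumes "finite M"
  obtains f where "bij_betw f {1..card M} M" "strict_mono_on {1..card M} f"
proof -
  from ex_bij_betw_strict_mono_card[OF assms] obtain h
    where h: "bij_betw h {..<card M} M" "strict_mono_on {..<card M} h"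
    by blast
  have "bij_betw (\<lambda>x. x - 1) {1..card M} {..<card M}"
    by (rule bij_betw_byWitness[where f' = Suc]) auto
  then have "bij_betw (h \<circ> (\<lambda>x. x - 1)) {1..card M} M"
    using h(1) by (rule bij_betw_trans)
  moreover have "strict_mono_on {1..card M} (h \<circ> (\<lambda>x. x - 1))"
  proof (rule strict_mono_onI)
    fix r s assume "r \<in> {1..card M}" "s \<in> {1..card M}" "r < s"
    then show "(h \<circ> (\<lambda>x. x - 1)) r < (h \<circ> (\<lambda>x. x - 1)) s"
      using strict_mono_onD[OF h(2), of "r - 1" "s - 1"] by auto
  qed
  ultimately show ?thesis
    by (rule that)
qed

text \<open>One set for all \<open>n\<close>: the constraints of the symmetric extension at
  \<open>n\<close> turn out to be its members with support in \<open>{1..n}\<close>. The value 0 is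
  excluded because the ground sets start at 1.\<close>

definition relabellings :: "constraint set \<Rightarrow> constraint set" where
  "relabellings C = {relabel f P | f P. P \<in> C \<and> strict_mono_on (support P) f \<and> 0 \<notin> f ` support P}"

lemma relabel_in_relabellings:
  assumes "Q \<in> relabellings C" "strict_mono_on (support Q) g" "0 \<notin> g ` support Q"
  shows "relabel g Q \<in> relabellings C"
proof -
  obtain f P where P: "Q = relabel f P" "P \<in> C" "strict_mono_on (support P) f"
    using assms(1) unfolding relabellings_def by blast
  have "strict_mono_on (support P) (g \<circ> f)"
    using P(3) assms(2) by (auto simp: P(1) support_relabel strict_mono_on_def)
  moreover have "0 \<notin> (g \<circ> f) ` support P"
    using assms(3) by (simp add: P(1) support_relabel image_comp)
  ultimately show ?thesis
    unfolding relabellings_def P(1) relabel_relabel using P(2) by blast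
qed

lemma order_preserving_iff:
  "order_preserving A n f \<longleftrightarrow> f ` A \<subseteq> {1..n} \<and> strict_mono_on A f"
  unfolding order_preserving_def
  by (metis strict_mono_on_less strict_mono_onI)

text \<open>For \<open>n > n0\<close>, an increasing map defined on a support alone need not extend to \<open>{1..n0}\<close>; the
  symmetry of \<open>C\<close> allows to replace the constraint by its preimage under an increasing
  enumeration of an \<open>n0\<close>-subset that contains the new support.\<close>

lemma extension_constraints_eq:
  assumes supp: "supported_on n0 C" and sym: "symmetric n0 C"
  shows "extension_constraints n0 C n = {Q \<in> relabellings C. support Q \<subseteq> {1..n}}"
proof -
  have C_sub: "C \<subseteq> relabellings C"
  proof
    fix P assume "P \<in> C"
    then have "0 \<notin> id ` support P"
      using supp by (force simp: supported_on_def)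
    moreover have "P = relabel id P" "strict_mono_on (support P) id"
      by (simp_all add: relabel_ident strict_mono_on_def)
    ultimately show "P \<in> relabellings C"
      unfolding relabellings_def using \<open>P \<in> C\<close> by blast
  qed
  have C_closed: "relabel f P \<in> C"
    if "P \<in> C" "strict_mono_on (support P) f" "f ` support P \<subseteq> {1..n0}" for f P
    using sym that unfolding symmetric_def order_preserving_iff by blast
  show ?thesis
  proof (cases "n \<le> n0")
    case True
    have "Q \<in> C" if Q: "Q \<in> relabellings C" "support Q \<subseteq> {1..n}" for Q
    proof -
      obtain f P where P: "Q = relabel f P" "P \<in> C" "strict_mono_on (support P) f"
        using Q(1) unfolding relabellings_def by blast
      moreover have "f ` support P \<subseteq> {1..n0}"
        using Q(2) True by (auto simp: P(1) support_relabel)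
      ultimately show ?thesis
        using C_closed by simp
    qed
    then show ?thesis
      using True C_sub by (auto simp: extension_constraints_def)
  next
    case False
    let ?E = "{relabel f P | f P. P \<in> C \<and> order_preserving {1..n0} n f}"
    have "C \<subseteq> {Q \<in> relabellings C. support Q \<subseteq> {1..n}}"
      using C_sub supp False by (fastforce simp: supported_on_def)
    moreover have "?E \<subseteq> {Q \<in> relabellings C. support Q \<subseteq> {1..n}}"
    proof
      fix Q assume "Q \<in> ?E"
      then obtain f P where P: "Q = relabel f P" "P \<in> C" "f ` {1..n0} \<subseteq> {1..n}"
        "strict_mono_on {1..n0} f"
        unfolding order_preserving_iff by blast
      have sub: "support P \<subseteq> {1..n0}"
        using supp P(2) by (simp add: supported_on_def)
      then have mono: "strict_mono_on (support P) f"
        by (rule monotone_on_subset[OF P(4)])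
      have img: "f ` support P \<subseteq> {1..n}"
        using sub P(3) by blast
      then have "0 \<notin> f ` support P"
        by auto
      then have "Q \<in> relabellings C"
        unfolding relabellings_def using P(1,2) mono by blast
      then show "Q \<in> {Q \<in> relabellings C. support Q \<subseteq> {1..n}}"
        using img by (simp add: P(1) support_relabel)
    qed
    moreover have "Q \<in> ?E" if Q: "Q \<in> relabellings C" "support Q \<subseteq> {1..n}" for Q
    proof -
      obtain g P where P: "Q = relabel g P" "P \<in> C" "strict_mono_on (support P) g"
        using Q(1) unfolding relabellings_def by blast
      have supp_Q: "support Q = g ` support P"
        by (simp add: P(1) support_relabel)
      have sub: "support P \<subseteq> {1..n0}"
        using supp P(2) by (simp add: supported_on_def)
      have "card (support Q) \<le> card (support P)"
        unfolding supp_Q by (rule card_image_le) (rule finite_subset[OF sub], simp)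
      also have "\<dots> \<le> n0"
        using card_mono[OF _ sub] by simp
      finally obtain U where U: "support Q \<subseteq> U" "U \<subseteq> {1..n}" "card U = n0"
        using exists_subset_between[of "support Q" n0 "{1..n}"] Q(2) False by auto
      have "finite U"
        using U(2) finite_subset by blast
      then obtain f where f: "bij_betw f {1..n0} U" "strict_mono_on {1..n0} f"
        using obtain_increasing_enumeration[of U] U(3) by blast
      \<comment> \<open>The composite of \<open>g\<close> and \<open>f'\<close> is increasing from
        \<open>support P\<close> into \<open>{1..n0}\<close>, so symmetry applies to it;
        \<open>f\<close> then leads back to \<open>Q\<close> and is increasing on all of
        \<open>{1..n0}\<close>.\<close>
      define f' where "f' = the_inv_into {1..n0} f"
      have img: "f ` {1..n0} = U" and inj: "inj_on f {1..n0}"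
        using f(1) by (auto simp: bij_betw_def)
      have "strict_mono_on U f'"
        using strict_mono_on_the_inv_into[OF f(2)] by (simp only: f'_def img)
      then have "strict_mono_on (support P) (f' \<circ> g)"
        using P(3) U(1) by (auto simp: strict_mono_on_def supp_Q image_subset_iff)
      moreover have "f' ` U = {1..n0}"
        using the_inv_into_onto[OF inj] by (simp only: f'_def img)
      then have "(f' \<circ> g) ` support P \<subseteq> {1..n0}"
        using U(1) unfolding supp_Q image_comp[symmetric] by blast
      ultimately have "relabel f' Q \<in> C"
        using C_closed P(2) by (simp add: P(1) relabel_relabel)
      moreover have "Q = relabel f (relabel f' Q)"
        unfolding f'_def using relabel_the_inv_into'[OF inj] U(1) img by simp
      moreover have "order_preserving {1..n0} n f"
        unfolding order_preserving_iff using f(2) img U(2) by simp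
      ultimately show ?thesis
        by blast
    qed
    ultimately show ?thesis
      using False unfolding extension_constraints_def by auto
  qed
qed

text \<open>For finite \<open>Q\<close> this is the number of \<open>k\<close>-tuples of members of
  \<open>K\<close> with union \<open>Q\<close>. It does not refer to \<open>n\<close>, and the sum
  is finite even if \<open>K\<close> is infinite.\<close>

fun cover_count :: "constraint set \<Rightarrow> nat \<Rightarrow> constraint \<Rightarrow> nat" where
  "cover_count K 0 Q = (if Q = {} then 1 else 0)"
| "cover_count K (Suc k) Q = (\<Sum>(P, R) \<in> {(P, R). P \<in> K \<and> P \<union> R = Q}. cover_count K k R)"

text \<open>A union of \<open>k\<close> sets of at most \<open>m\<close> edges has at most
  \<open>m * k\<close> edges, so every constraint that occurs in the \<open>k\<close>-th power has
  fewer edges than any cycle.\<close>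

lemma card_le_if_cover_count:
  assumes "\<And>P. P \<in> K \<Longrightarrow> card P \<le> m" "cover_count K k Q \<noteq> 0"
  shows "card Q \<le> m * k"
  using assms(2)
proof (induction k arbitrary: Q)
  case (Suc k)
  then have "(\<Sum>(P, R) \<in> {(P, R). P \<in> K \<and> P \<union> R = Q}. cover_count K k R) \<noteq> 0"
    by simp
  then obtain e where "e \<in> {(P, R). P \<in> K \<and> P \<union> R = Q}"
    "(case e of (P, R) \<Rightarrow> cover_count K k R) \<noteq> 0"
    by (rule sum.not_neutral_contains_not_neutral)
  then obtain P R where "P \<in> K" "P \<union> R = Q" "cover_count K k R \<noteq> 0"
    by auto
  then have "card Q \<le> card P + card R" "card P \<le> m" "card R \<le> m * k"
    using card_Un_le assms(1) Suc.IH by blast+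
  then show ?case
    by simp
qed (auto split: if_splits)

text \<open>Relabelling by \<open>f\<close> and by its inverse transports the pairs
  \<open>(P, R)\<close> in both directions, since \<open>relabellings C\<close> is closed under
  increasing maps avoiding 0 and the supports of \<open>P\<close> and \<open>R\<close> lie in that
  of \<open>Q\<close>.\<close>

lemma cover_count_relabel:
  assumes "strict_mono_on (support Q) f" "0 \<notin> support Q" "0 \<notin> f ` support Q"
  shows "cover_count (relabellings C) k (relabel f Q) = cover_count (relabellings C) k Q"
  using assms
proof (induction k arbitrary: Q)
  case 0
  then show ?case
    by (simp add: relabel_def)
next
  case (Suc k)
  define K where "K = relabellings C"
  define f' where "f' = the_inv_into (support Q) f"
  have inj: "inj_on f (support Q)"
    using Suc.prems(1) by (rule strict_mono_on_imp_inj_on)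
  have mono': "strict_mono_on (f ` support Q) f'"
    unfolding f'_def using Suc.prems(1) by (rule strict_mono_on_the_inv_into)
  have f'_img: "f' ` f ` support Q \<subseteq> support Q"
    using the_inv_into_into[OF inj] by (auto simp: f'_def)
  have sub: "support P \<subseteq> support Q" "support R \<subseteq> support Q" if "P \<union> R = Q" for P R
    using that by (auto simp: support_def)
  have sub': "support P \<subseteq> f ` support Q" "support R \<subseteq> f ` support Q"
    if "P \<union> R = relabel f Q" for P R
    using that unfolding support_relabel[symmetric] by (auto simp: support_def simp flip: that)
  have "(\<Sum>(P, R) \<in> {(P, R). P \<in> K \<and> P \<union> R = Q}. cover_count K k R) =
    (\<Sum>(P, R) \<in> {(P, R). P \<in> K \<and> P \<union> R = relabel f Q}. cover_count K k R)"
  proof (rule sum.reindex_bij_witness[where i = "map_prod (relabel f') (relabel f')"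
        and j = "map_prod (relabel f) (relabel f)"])
    fix e assume "e \<in> {(P, R). P \<in> K \<and> P \<union> R = Q}"
    then obtain P R where e: "e = (P, R)" "P \<in> K" "P \<union> R = Q"
      by blast
    show "map_prod (relabel f') (relabel f') (map_prod (relabel f) (relabel f) e) = e"
      using sub[OF e(3)] relabel_the_inv_into[OF inj] by (simp add: e(1) f'_def)
    have "0 \<notin> f ` support P"
      using sub[OF e(3)] Suc.prems(3) by blast
    then have "relabel f P \<in> K"
      using relabel_in_relabellings e(2) monotone_on_subset[OF Suc.prems(1)] sub[OF e(3)]
      unfolding K_def by blast
    then show "map_prod (relabel f) (relabel f) e \<in> {(P, R). P \<in> K \<and> P \<union> R = relabel f Q}"
      using e(3) by (auto simp: e(1) simp flip: relabel_Un)
    have "cover_count K k (relabel f R) = cover_count K k R"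
      unfolding K_def using sub[OF e(3)] Suc.prems monotone_on_subset[OF Suc.prems(1)]
      by (intro Suc.IH) blast+
    then show "(case map_prod (relabel f) (relabel f) e of (P, R) \<Rightarrow> cover_count K k R) =
      (case e of (P, R) \<Rightarrow> cover_count K k R)"
      by (simp add: e(1))
  next
    fix e assume "e \<in> {(P, R). P \<in> K \<and> P \<union> R = relabel f Q}"
    then obtain P R where e: "e = (P, R)" "P \<in> K" "P \<union> R = relabel f Q"
      by blast
    show "map_prod (relabel f) (relabel f) (map_prod (relabel f') (relabel f') e) = e"
      using sub'[OF e(3)] relabel_the_inv_into'[OF inj] by (simp add: e(1) f'_def)
    have "0 \<notin> f' ` support P"
      using sub'[OF e(3)] Suc.prems(2) f'_img by blast
    then have "relabel f' P \<in> K"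
      using relabel_in_relabellings e(2) monotone_on_subset[OF mono'] sub'[OF e(3)]
      unfolding K_def by blast
    moreover have "relabel f' P \<union> relabel f' R = Q"
      unfolding relabel_Un[symmetric] e(3) f'_def using inj by (simp add: relabel_the_inv_into)
    ultimately show "map_prod (relabel f') (relabel f') e \<in> {(P, R). P \<in> K \<and> P \<union> R = Q}"
      by (simp add: e(1))
  qed
  then show ?case
    by (simp add: K_def)
qed

section \<open>Expansion of powers and grouping by the size of the support\<close>

lemma support_subset_iff: "support Q \<subseteq> {1..n} \<longleftrightarrow> Q \<in> Pow ({1..n} \<times> {1..n})"
  unfolding support_def by force

text \<open>A product of indicators is the indicator of the union of the constraints, so the terms
  of the expanded power are collected by their union \<open>Q\<close>.\<close>

lemma statistic_power:
  "statistic {Q \<in> K. support Q \<subseteq> {1..n}} w ^ k =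
    (\<Sum>Q \<in> Pow ({1..n} \<times> {1..n}). real (cover_count K k Q) * of_bool (satisfies w Q))"
proof (induction k)
  case 0
  have "(\<Sum>Q \<in> Pow ({1..n} \<times> {1..n}). real (cover_count K 0 Q) * of_bool (satisfies w Q)) =
    (\<Sum>Q \<in> Pow ({1..n} \<times> {1..n}). if Q = {} then 1 else 0)"
    by (rule sum.cong) (auto simp: satisfies_def)
  then show ?case
    by simp
next
  case (Suc k)
  define U where "U = Pow ({1..n} \<times> {1..n})"
  define A where "A = {Q \<in> K. support Q \<subseteq> {1..n}}"
  have A: "A = K \<inter> U"
    unfolding A_def U_def support_subset_iff by blast
  have fin: "finite U" "finite A"
    by (simp_all add: A U_def)
  have sat_Un: "satisfies w (P \<union> R) \<longleftrightarrow> satisfies w P \<and> satisfies w R" for P R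
    by (auto simp: satisfies_iff)
  have "statistic A w ^ Suc k = (\<Sum>(P, R) \<in> A \<times> U.
      of_bool (satisfies w P) * (real (cover_count K k R) * of_bool (satisfies w R)))"
    using Suc.IH unfolding A_def[symmetric] U_def[symmetric]
    by (simp add: statistic_def sum_product sum.cartesian_product)
  also have "\<dots> = (\<Sum>e \<in> A \<times> U. real (cover_count K k (snd e)) * of_bool (satisfies w (fst e \<union> snd e)))"
    by (rule sum.cong) (auto simp: sat_Un)
  also have "\<dots> = (\<Sum>Q \<in> U. \<Sum>e \<in> {e \<in> A \<times> U. fst e \<union> snd e = Q}.
      real (cover_count K k (snd e)) * of_bool (satisfies w (fst e \<union> snd e)))"
    by (rule sum.group[symmetric]) (use fin in \<open>auto simp: A U_def\<close>)
  also have "\<dots> = (\<Sum>Q \<in> U. real (cover_count K (Suc k) Q) * of_bool (satisfies w Q))"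
  proof (rule sum.cong[OF refl])
    \<comment> \<open>If a union lies in the square of \<open>{1..n}\<close>, so do both members;
      hence the untruncated \<open>K\<close> gives the same multiplicity as
      \<open>A\<close>.\<close>
    fix Q assume "Q \<in> U"
    then have "{e \<in> A \<times> U. fst e \<union> snd e = Q} = {(P, R). P \<in> K \<and> P \<union> R = Q}"
      by (auto simp: A U_def)
    then show "(\<Sum>e \<in> {e \<in> A \<times> U. fst e \<union> snd e = Q}.
        real (cover_count K k (snd e)) * of_bool (satisfies w (fst e \<union> snd e))) =
      real (cover_count K (Suc k) Q) * of_bool (satisfies w Q)"
      by (auto simp: sum_distrib_right case_prod_beta intro!: sum.cong)
  qed
  finally show ?case
    by (simp only: A_def U_def)
qed

text \<open>The increasing enumeration of a set \<open>S\<close> of size \<open>u\<close> matches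
  the constraints with support \<open>{1..u}\<close> to those with support \<open>S\<close> and
  preserves \<open>G\<close>; there are \<open>n choose u\<close> such sets.\<close>

lemma sum_over_constraints:
  fixes G :: "constraint \<Rightarrow> real"
  assumes inv: "\<And>f Q. \<lbrakk>strict_mono_on (support Q) f; 0 \<notin> support Q; 0 \<notin> f ` support Q\<rbrakk>
      \<Longrightarrow> G (relabel f Q) = G Q"
  shows "(\<Sum>Q \<in> Pow ({1..n} \<times> {1..n}). G Q) =
    (\<Sum>u \<le> n. real (n choose u) * (\<Sum>Q | support Q = {1..u}. G Q))"
proof -
  define h where "h u = (\<Sum>Q | support Q = {1..u}. G Q)" for u
  have fibre: "(\<Sum>Q | support Q = S. G Q) = h (card S)" if S: "S \<in> Pow {1..n}" for S
  proof -
    have "finite S"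
      using S finite_subset by auto
    then obtain f where f: "bij_betw f {1..card S} S" "strict_mono_on {1..card S} f"
      by (rule obtain_increasing_enumeration)
    then have inj: "inj_on f {1..card S}" and img: "f ` {1..card S} = S"
      by (auto simp: bij_betw_def)
    have img': "the_inv_into {1..card S} f ` S = {1..card S}"
      using the_inv_into_onto[OF inj] by (simp only: img)
    have "h (card S) = (\<Sum>Q | support Q = S. G Q)"
      unfolding h_def
    proof (rule sum.reindex_bij_witness[where i = "relabel (the_inv_into {1..card S} f)"
          and j = "relabel f"])
      fix Q assume "Q \<in> {Q. support Q = {1..card S}}"
      then have Q: "support Q = {1..card S}"
        by simp
      show "relabel (the_inv_into {1..card S} f) (relabel f Q) = Q"
        using inj by (rule relabel_the_inv_into) (simp add: Q)
      show "relabel f Q \<in> {Q. support Q = S}"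
        by (simp add: support_relabel Q img del: One_nat_def)
      show "G (relabel f Q) = G Q"
        by (rule inv) (use f(2) S img Q in \<open>auto simp del: One_nat_def\<close>)
    next
      fix Q assume "Q \<in> {Q. support Q = S}"
      then have Q: "support Q = S"
        by simp
      show "relabel f (relabel (the_inv_into {1..card S} f) Q) = Q"
        using inj by (rule relabel_the_inv_into') (simp only: Q img)
      show "relabel (the_inv_into {1..card S} f) Q \<in> {Q. support Q = {1..card S}}"
        by (simp add: support_relabel Q img' del: One_nat_def)
    qed
    then show ?thesis ..
  qed
  have "(\<Sum>Q \<in> Pow ({1..n} \<times> {1..n}). G Q) =
    (\<Sum>S \<in> Pow {1..n}. \<Sum>Q \<in> {Q \<in> Pow ({1..n} \<times> {1..n}). support Q = S}. G Q)"
  proof (rule sum.group[symmetric])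
    show "support ` Pow ({1..n} \<times> {1..n}) \<subseteq> Pow {1..n}"
      using support_subset_iff[of _ n] by blast
  qed simp_all
  also have "\<dots> = (\<Sum>S \<in> Pow {1..n}. h (card S))"
  proof (rule sum.cong[OF refl])
    fix S assume S: "S \<in> Pow {1..n}"
    then have "{Q \<in> Pow ({1..n} \<times> {1..n}). support Q = S} = {Q. support Q = S}"
      unfolding support_subset_iff[symmetric] by auto
    then show "(\<Sum>Q \<in> {Q \<in> Pow ({1..n} \<times> {1..n}). support Q = S}. G Q) = h (card S)"
      using fibre[OF S] by (simp only:)
  qed
  also have "\<dots> = (\<Sum>u \<le> n. \<Sum>S \<in> {S \<in> Pow {1..n}. card S = u}. h (card S))"
    by (rule sum.group[symmetric]) (auto dest: card_mono[rotated])
  also have "\<dots> = (\<Sum>u \<le> n. real (n choose u) * h u)"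
  proof (rule sum.cong[OF refl])
    fix u
    have "card {S. S \<subseteq> {1..n} \<and> card S = u} = n choose u"
      using n_subsets[of "{1..n}" u] by simp
    then show "(\<Sum>S \<in> {S \<in> Pow {1..n}. card S = u}. h (card S)) = real (n choose u) * h u"
      by simp
  qed
  finally show ?thesis
    by (simp only: h_def)
qed

section \<open>Polynomiality\<close>

text \<open>\<open>real (n choose u) * fact u / ((n - 1) \<cdots> (n - l))\<close> as a polynomial in \<open>n\<close>, for \<open>l < u\<close> or
  \<open>u = l = 0\<close>.\<close>

definition support_poly :: "nat \<Rightarrow> nat \<Rightarrow> real poly" where
  "support_poly u l = (if u = 0 then 1 else [:0, 1:] * (\<Prod>j \<in> {Suc l..<u}. [:- real j, 1:]))"

lemma poly_support_poly:
  assumes "l < u \<or> u = 0 \<and> l = 0" "l < n"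
  shows "poly (support_poly u l) (real n) / fact u = real (n choose u) / real (\<Prod>j = 1..l. n - j)"
proof (cases "u = 0")
  case True
  with assms show ?thesis
    by (simp add: support_poly_def)
next
  case False
  with assms have l: "l < u"
    by simp
  have nz: "real (\<Prod>j = 1..l. n - j) \<noteq> 0"
    using assms(2) by auto
  have "real (n choose u) * fact u = (\<Prod>j = 0..<u. real n - real j)"
    by (simp add: binomial_gbinomial gbinomial_prod_rev)
  \<comment> \<open>Of the factors of the falling factorial, those for \<open>j\<close> from 1 to
    \<open>l\<close> form the denominator and the others the polynomial; \<open>l < u\<close>
    ensures that the whole denominator occurs.\<close>
  also have "{0..<u} = insert 0 ({1..l} \<union> {Suc l..<u})"
    using l by auto
  also have "(\<Prod>j \<in> \<dots>. real n - real j) =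
      real n * ((\<Prod>j = 1..l. real n - real j) * (\<Prod>j \<in> {Suc l..<u}. real n - real j))"
    by (subst prod.insert) (auto intro: prod.union_disjoint)
  also have "(\<Prod>j = 1..l. real n - real j) = real (\<Prod>j = 1..l. n - j)"
    unfolding of_nat_prod using assms(2) by (intro prod.cong) (auto simp: of_nat_diff)
  also have "real n * (real (\<Prod>j = 1..l. n - j) * (\<Prod>j \<in> {Suc l..<u}. real n - real j)) =
      poly (support_poly u l) (real n) * real (\<Prod>j = 1..l. n - j)"
    using False by (simp add: support_poly_def poly_prod algebra_simps)
  finally show ?thesis
    using nz by (simp add: field_simps)
qed

text \<open>Edges are counted by their heads, and the start of a path is a vertex but no head. This
  supplies the inequality that lets the denominator cancel.\<close>

lemma card_lt_card_support:
  assumes "path_forest Q" "finite Q" "Q \<noteq> {}"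
  shows "card Q < card (support Q)"
proof -
  obtain i j where "(i, j) \<in> Q"
    using assms(3) by auto
  obtain s where s: "(s, i) \<in> Q\<^sup>*" "s \<notin> Range Q"
    using unique_path_start[OF assms(2,1), of i] by blast
  then have "s \<in> Domain Q"
    using \<open>(i, j) \<in> Q\<close> by (auto elim: converse_rtranclE)
  then have "Range Q \<subset> support Q"
    using s(2) Range_subset_support[of Q] Domain_subset_support[of Q] by blast
  then show ?thesis
    using psubset_card_mono finite_support[OF assms(2)] card_Range_path_forest[OF assms(1)] by metis
qed

text \<open>Together with the bound on the number of edges, this cuts the support sizes at
  \<open>2 * L\<close>, independently of \<open>n\<close>.\<close>

lemma card_support_le: "finite Q \<Longrightarrow> card (support Q) \<le> 2 * card Q"
  unfolding support_def
  by (rule order_trans[OF card_Un_le]) (metis add_mono card_image_le mult_2)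

section \<open>Expectation over a class and assembly of the polynomial\<close>

lemma conj_expectation_eq:
  assumes "is_partition n lam"
  shows "conj_expectation n lam X = (\<Sum>w \<in> conj_class n lam. X w) / real (card (conj_class n lam))"
  unfolding conj_expectation_def
  using conj_class_nonempty[OF assms] finite_conj_class by (rule integral_pmf_of_set)

theorem theorem1p5:
  fixes k m n0 :: nat and C :: "constraint set"
  assumes "k \<ge> 1" and "m \<ge> 1"
    and "supported_on n0 C" and "size_of C = m" and "symmetric n0 C"
  shows "\<exists>p :: real poly. \<forall>lam :: nat \<Rightarrow> nat multiset.
           (\<forall>n \<ge> m * k + 1. is_partition n (lam n) \<and> (\<forall>a \<in># lam n. a \<ge> m * k + 1)) \<longrightarrow>
           (\<forall>n \<ge> m * k + 1.
              poly p (real n) = conj_expectation n (lam n) (\<lambda>w. symmetric_extension n0 C n w ^ k))"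
proof -
  define N where "N = cover_count (relabellings C) k"
  define L where "L = m * k"
  \<comment> \<open>The witness is built from \<open>N\<close> and \<open>L\<close> alone and
    involves neither \<open>n\<close> nor a cycle type. Constraints with more than \<open>L\<close>
    edges may occur in the sum, but their coefficient \<open>N Q\<close> is zero.\<close>
  define p where "p = (\<Sum>u \<le> 2 * L. \<Sum>Q | support Q = {1..u} \<and> path_forest Q.
    smult (real (N Q) / fact u) (support_poly u (card Q)))"
  have "C \<subseteq> Pow ({1..n0} \<times> {1..n0})"
    using assms(3) unfolding supported_on_def support_subset_iff by blast
  then have "finite C"
    by (rule finite_subset) simp
  then have card_C: "card P \<le> m" if "P \<in> C" for P
    using assms(4) that unfolding size_of_def by (metis Max_ge finite_imageI imageI)
  have "card Q \<le> m" if Q: "Q \<in> relabellings C" for Q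
  proof -
    obtain f P where "Q = relabel f P" "P \<in> C" "strict_mono_on (support P) f"
      using Q unfolding relabellings_def by blast
    then show ?thesis
      using card_C card_relabel[OF strict_mono_on_imp_inj_on] by simp
  qed
  then have N_card: "card Q \<le> L" if "N Q \<noteq> 0" for Q
    using that card_le_if_cover_count unfolding N_def L_def by blast
  have main: "poly p (real n) = conj_expectation n lam (\<lambda>w. symmetric_extension n0 C n w ^ k)"
    if n: "L < n" and part: "is_partition n lam" and lam: "\<forall>a \<in># lam. L < a" for n lam
  proof -
    define U where "U = Pow ({1..n} \<times> {1..n})"
    define c where "c = real (card (conj_class n lam))"
    \<comment> \<open>This is multiplicity times probability, the contribution of \<open>Q\<close>
      to the expectation, in a form that no longer refers to \<open>lam\<close>.\<close>
    define G where "G Q = (if path_forest Q then real (N Q) / real (\<Prod>j = 1..card Q. n - j) else 0)" for Q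
    have "c \<noteq> 0"
      using conj_class_nonempty[OF part] finite_conj_class by (simp add: c_def)
    have prob: "real (N Q) * real (card (sat_perms n lam Q)) / c = G Q" if "Q \<in> U" for Q
    proof (cases "N Q = 0")
      case False
      then have le: "card Q \<le> L"
        by (rule N_card)
      have supp: "support Q \<subseteq> {1..n}"
        using that by (simp only: support_subset_iff U_def)
      show ?thesis
      proof (cases "path_forest Q")
        case True
        have "real (\<Prod>j = 1..card Q. n - j) \<noteq> 0"
          using le n by auto
        moreover have "real (card (sat_perms n lam Q)) * real (\<Prod>j = 1..card Q. n - j) = c"
          unfolding c_def of_nat_mult[symmetric] card_sat_perms[OF lam n True supp le] ..
        ultimately show ?thesis
          using \<open>c \<noteq> 0\<close> True by (simp add: G_def field_simps del: of_nat_prod)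
      next
        case pf: False
        have "finite Q"
          using supp by (intro finite_constraint) (rule finite_subset, auto)
        moreover have "fst ` Q \<subseteq> {1..n}"
          using supp by (simp add: support_def)
        ultimately have "sat_perms n lam Q = {}"
          using path_forest_if_satisfied[OF _ le _ lam] pf by blast
        then show ?thesis
          using pf by (simp add: G_def)
      qed
    qed (simp add: G_def)
    have "conj_expectation n lam (\<lambda>w. symmetric_extension n0 C n w ^ k) =
      (\<Sum>w \<in> conj_class n lam. \<Sum>Q \<in> U. real (N Q) * of_bool (satisfies w Q)) / c"
      unfolding conj_expectation_eq[OF part] symmetric_extension_def
        extension_constraints_eq[OF assms(3,5)] statistic_power N_def U_def c_def ..
    also have "\<dots> = (\<Sum>Q \<in> U. real (N Q) * (\<Sum>w \<in> conj_class n lam. of_bool (satisfies w Q))) / c"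
      by (subst sum.swap) (simp add: sum_distrib_left)
    also have "\<dots> = (\<Sum>Q \<in> U. real (N Q) * real (card (sat_perms n lam Q)) / c)"
      using finite_conj_class[of n lam]
      by (simp add: sum_divide_distrib sat_perms_def Int_def)
    also have "\<dots> = (\<Sum>Q \<in> U. G Q)"
      by (rule sum.cong[OF refl prob])
    also have "\<dots> = (\<Sum>u \<le> n. real (n choose u) * (\<Sum>Q | support Q = {1..u}. G Q))"
      unfolding U_def
    proof (rule sum_over_constraints)
      fix f :: "nat \<Rightarrow> nat" and Q assume f: "strict_mono_on (support Q) f" "0 \<notin> support Q" "0 \<notin> f ` support Q"
      have "inj_on f (support Q)"
        using f(1) by (rule strict_mono_on_imp_inj_on)
      then show "G (relabel f Q) = G Q"
        unfolding G_def N_def by (simp add: path_forest_relabel card_relabel cover_count_relabel[OF f])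
    qed
    \<comment> \<open>Both ranges are compared with their maximum: the binomials vanish for
      \<open>u > n\<close>, and for \<open>u > 2 * L\<close> no \<open>Q\<close> with that support
      has a nonzero multiplicity.\<close>
    also have "\<dots> = (\<Sum>u \<le> 2 * L. real (n choose u) * (\<Sum>Q | support Q = {1..u}. G Q))"
    proof -
      let ?t = "\<lambda>u. real (n choose u) * (\<Sum>Q | support Q = {1..u}. G Q)"
      have large: "?t u = 0" if "u > 2 * L" for u
      proof -
        have "G Q = 0" if Q: "support Q = {1..u}" for Q
        proof -
          have "u \<le> 2 * card Q"
            using card_support_le[OF finite_constraint, of Q] by (simp add: Q)
          then have "N Q = 0"
            using N_card[of Q] \<open>u > 2 * L\<close> by fastforce
          then show ?thesis
            by (simp add: G_def)
        qed
        then show ?thesis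
          by simp
      qed
      have "sum ?t {..2 * L} = sum ?t {..max n (2 * L)}"
      proof (rule sum.mono_neutral_left)
        show "\<forall>u \<in> {..max n (2 * L)} - {..2 * L}. ?t u = 0"
        proof
          fix u assume "u \<in> {..max n (2 * L)} - {..2 * L}"
          then have "u > 2 * L"
            by simp
          then show "?t u = 0"
            by (rule large)
        qed
      qed auto
      moreover have "sum ?t {..n} = sum ?t {..max n (2 * L)}"
        by (rule sum.mono_neutral_left) auto
      ultimately show ?thesis
        by (simp only:)
    qed
    also have "\<dots> = (\<Sum>u \<le> 2 * L. \<Sum>Q | support Q = {1..u} \<and> path_forest Q.
      real (N Q) / fact u * poly (support_poly u (card Q)) (real n))"
    proof (rule sum.cong[OF refl])
      fix u
      have fin: "finite {Q. support Q = {1..u}}"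
        by (rule finite_subset[of _ "Pow ({1..u} \<times> {1..u})"])
          (use support_subset_iff in \<open>blast, simp\<close>)
      have "real (n choose u) * (\<Sum>Q | support Q = {1..u}. G Q) =
        (\<Sum>Q | support Q = {1..u} \<and> path_forest Q. real (n choose u) * G Q)"
        unfolding sum_distrib_left
        by (rule sum.mono_neutral_right[OF fin]) (auto simp: G_def)
      also have "\<dots> = (\<Sum>Q | support Q = {1..u} \<and> path_forest Q.
        real (N Q) / fact u * poly (support_poly u (card Q)) (real n))"
      proof (rule sum.cong[OF refl])
        fix Q assume "Q \<in> {Q. support Q = {1..u} \<and> path_forest Q}"
        then have Q: "support Q = {1..u}" "path_forest Q"
          by auto
        have "finite Q"
          by (rule finite_constraint) (simp add: Q)
        \<comment> \<open>The empty constraint is the case \<open>u = 0\<close>, where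
          \<open>support_poly\<close> is 1; any other union of paths has more vertices than
          edges.\<close>
        then have lu: "card Q < u \<or> u = 0 \<and> card Q = 0"
          using card_lt_card_support[OF Q(2)] Q(1) by (cases "Q = {}") (auto simp: support_def)
        show "real (n choose u) * G Q = real (N Q) / fact u * poly (support_poly u (card Q)) (real n)"
        proof (cases "N Q = 0")
          case False
          then have "card Q < n"
            using N_card[of Q] n by simp
          then have "real (n choose u) / real (\<Prod>j = 1..card Q. n - j) =
            poly (support_poly u (card Q)) (real n) / fact u"
            by (rule poly_support_poly[OF lu, symmetric])
          moreover have "real (n choose u) * G Q =
            real (N Q) * (real (n choose u) / real (\<Prod>j = 1..card Q. n - j))"
            using Q(2) by (simp add: G_def)
          ultimately show ?thesis
            by simp
        qed (simp add: G_def)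
      qed
      finally show "real (n choose u) * (\<Sum>Q | support Q = {1..u}. G Q) = \<dots>" .
    qed
    also have "\<dots> = poly p (real n)"
      by (simp add: p_def poly_sum)
    finally show ?thesis ..
  qed
  show ?thesis
    by (rule exI[of _ p]) (use main in \<open>auto simp: L_def Suc_le_eq\<close>)
qed

end
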